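(* Let $X$ be a random motion governed by a point process $N$ and moving with velocities $v_0,\dots,v_M\in\mathbb{R}^D$, $M\in\mathbb{N}$, such that $\dim\big(\mathrm{Conv}(v_0,\dots,v_M)\big)=R\le D$. Then the orthogonal projection $p_R:\mathbb{R}^D\to\mathbb{R}^R$ associated with $v_0,\dots,v_M$ (defined in the context) exists and, for $t\ge 0$, $X(t)$ is characterized by its projection $X^R(t)=p_R(X(t))$, in the sense that for every $A\subset\mathrm{Conv}(v_0t,\dots,v_Mt)$ one has $\{X(t)\in A\}=\{X^R(t)\in p_R(A)\}$; moreover $X^R(t)$ is the position at time $t$ of an $R$-dimensional random motion moving with velocities $p_R(v_0),\dots,p_R(v_M)$ and governed by $N$.
   Context: Random motion. Let $(W_n)_{n\ge 0}$ be random variables with $W_n\ge 0$ a.s. and $W_0=0$ a.s., let $T_n=\sum_{i=0}^n W_i$ and $N(t)=\max\{n\ge 0:\ T_n\le t\}$, with $N(t)<\infty$ a.s. for all $t\ge 0$. Let $V=\{V(t)\}_{t\ge 0}$ take values in $\{v_0,\dots,v_M\}\subset\mathbb{R}^D$ and change value only when $N$ records an event, so $V(t)=V(T_{N(t)})$. The random motion with velocities $v_0,\dots,v_M$ governed by $N$ is $X(t)=\int_0^tV(s)\,ds$. Projection. Let $R=\dim\mathrm{Conv}(v_0,\dots,v_M)$. Let $I^R$ be the set of indices of the first $R$ linearly independent rows (selected greedily from the top) of the $D\times M$ matrix with columns $v_h-v_k$, $h\ne k$; this set does not depend on $k$. Then $p_R:\mathbb{R}^D\to\mathbb{R}^R$,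 $p_R(x)=(x_i)_{i\in I^R}$. *)

theory Defs
  imports "HOL-Probability.Probability" "HOL-Library.Function_Algebras"
begin

text \<open>
  The space \<open>\<real>\<^sup>n\<close> is \<^term>\<open>topspace (Euclidean_space n)\<close>, that is, the functions
  \<open>x :: nat \<Rightarrow> real\<close> with \<open>x i = 0\<close> for \<open>i \<ge> n\<close>. Coordinates are therefore numbered from
  \<open>0\<close>, the dimension is an ordinary natural number, and \<open>n = 0\<close> is allowed. The pointwise
  vector space structure below makes \<^const>\<open>span\<close>, \<^const>\<open>dim\<close> and \<open>convex hull\<close>
  available for such vectors.
\<close>

instantiation "fun" :: (type, real_vector) real_vector
begin

definition scaleR_fun :: "real \<Rightarrow> ('a \<Rightarrow> 'b) \<Rightarrow> 'a \<Rightarrow> 'b"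
  where "scaleR_fun c f = (\<lambda>x. c *\<^sub>R f x)"

instance
  by standard (simp_all add: scaleR_fun_def fun_eq_iff scaleR_add_right scaleR_add_left)

end

lemma scaleR_fun_apply [simp]: "(c *\<^sub>R f) x = c *\<^sub>R f x"
  by (simp add: scaleR_fun_def)


section \<open>Dimension of a convex set\<close>

text \<open>
  The library's \<^const>\<open>aff_dim\<close> is restricted to the class \<^class>\<open>euclidean_space\<close>,
  to which \<open>nat \<Rightarrow> real\<close> does not belong. On nonempty sets it coincides with the dimension
  of the direction space, which makes sense in every real vector space.
\<close>

definition affine_dim :: "'a::real_vector set \<Rightarrow> nat"
  where "affine_dim S = dim {x - y | x y. x \<in> S \<and> y \<in> S}"

lemma aff_dim_eq_affine_dim:
  fixes S :: "'a::euclidean_space set"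
  assumes "S \<noteq> {}"
  shows "aff_dim S = int (affine_dim S)"
proof -
  obtain a where a: "a \<in> S"
    using assms by blast
  have "x - y \<in> span ((\<lambda>x. x - a) ` S)" if "x \<in> S" "y \<in> S" for x y
  proof -
    have "(x - a) - (y - a) \<in> span ((\<lambda>x. x - a) ` S)"
      using that by (intro span_diff span_base) auto
    then show ?thesis by simp
  qed
  then have "span {x - y | x y. x \<in> S \<and> y \<in> S} \<subseteq> span ((\<lambda>x. x - a) ` S)"
    by (intro span_minimal) auto
  moreover have "span ((\<lambda>x. x - a) ` S) \<subseteq> span {x - y | x y. x \<in> S \<and> y \<in> S}"
    using a by (intro span_mono) auto
  ultimately have "span {x - y | x y. x \<in> S \<and> y \<in> S} = span ((\<lambda>x. x - a) ` S)"
    by (rule subset_antisym)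
  then have "dim {x - y | x y. x \<in> S \<and> y \<in> S} = dim ((\<lambda>x. x - a) ` S)"
    by (rule span_eq_dim)
  then show ?thesis
    using aff_dim_eq_dim_subtract[of a S] a by (simp add: affine_dim_def hull_inc)
qed


section \<open>Random motions\<close>

definition arrival :: "(nat \<Rightarrow> 'w \<Rightarrow> real) \<Rightarrow> nat \<Rightarrow> 'w \<Rightarrow> real"
  where "arrival W n \<omega> = (\<Sum>i\<le>n. W i \<omega>)"

text \<open>
  On \<^typ>\<open>enat\<close>, the supremum of a finite nonempty set is its maximum and the supremum of
  an infinite set is \<open>\<infinity>\<close>.
\<close>

definition counting :: "(nat \<Rightarrow> 'w \<Rightarrow> real) \<Rightarrow> real \<Rightarrow> 'w \<Rightarrow> enat"
  where "counting W t \<omega> = (SUP n\<in>{n. arrival W n \<omega> \<le> t}. enat n)"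

definition point_process :: "'w measure \<Rightarrow> (nat \<Rightarrow> 'w \<Rightarrow> real) \<Rightarrow> bool"
  where "point_process P W \<longleftrightarrow>
    prob_space P \<and>
    (\<forall>n. W n \<in> borel_measurable P) \<and>
    (\<forall>n. AE \<omega> in P. 0 \<le> W n \<omega>) \<and>
    (AE \<omega> in P. W 0 \<omega> = 0) \<and>
    (\<forall>t\<ge>0. AE \<omega> in P. counting W t \<omega> < \<infinity>)"

text \<open>
  \<open>X\<close> is the random motion in \<open>\<real>\<^sup>n\<close> with velocities \<open>v 0, \<dots>, v M\<close> and velocity process
  \<open>V\<close>, governed by the counting process of \<open>W\<close>. Measurability into the count space over
  the velocities contains the requirement that \<open>V t\<close> takes its values among them. The
  relation between \<open>V\<close> and the counting process can only be required almost surely, since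
  the latter need not be finite everywhere. By contrast, \<open>X t\<close> is the (componentwise)
  integral of \<open>V\<close> for every \<open>\<omega>\<close>; almost surely the velocity path is a step function, so
  the existence of the integral is an issue on a null set only.
\<close>

definition random_motion ::
  "'w measure \<Rightarrow> (nat \<Rightarrow> 'w \<Rightarrow> real) \<Rightarrow> nat \<Rightarrow> nat \<Rightarrow> (nat \<Rightarrow> nat \<Rightarrow> real) \<Rightarrow>
   (real \<Rightarrow> 'w \<Rightarrow> nat \<Rightarrow> real) \<Rightarrow> (real \<Rightarrow> 'w \<Rightarrow> nat \<Rightarrow> real) \<Rightarrow> bool"
  where "random_motion P W n M v V X \<longleftrightarrow>
    point_process P W \<and>
    (\<forall>h\<le>M. v h \<in> topspace (Euclidean_space n)) \<and>
    (\<forall>t\<ge>0. V t \<in> measurable P (count_space (v ` {..M}))) \<and>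
    (AE \<omega> in P. \<forall>t\<ge>0. V t \<omega> = V (arrival W (the_enat (counting W t \<omega>)) \<omega>) \<omega>) \<and>
    (\<forall>t\<ge>0. \<forall>\<omega>\<in>space P. \<forall>i. ((\<lambda>s. V s \<omega> i) has_integral X t \<omega> i) {0..t})"


section \<open>The projection associated with the velocities\<close>

text \<open>
  Greedy selection, from the top, of at most \<open>R\<close> linearly independent rows among the first
  \<open>d\<close> rows \<open>r 0, r 1, \<dots>\<close>. Only the theorem shows that \<open>R\<close> rows are actually found.
\<close>

primrec greedy_rows :: "(nat \<Rightarrow> 'a::real_vector) \<Rightarrow> nat \<Rightarrow> nat \<Rightarrow> nat set"
  where
    "greedy_rows r R 0 = {}"
  | "greedy_rows r R (Suc d) =
      (let I = greedy_rows r R d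
       in if card I < R \<and> r d \<notin> span (r ` I) then insert d I else I)"

text \<open>
  Row \<open>i\<close> of the matrix with columns \<open>v h - v k\<close>, \<open>h \<noteq> k\<close>. Columns keep the label \<open>h\<close>, and
  a row is filled up with zeros at the labels that are not used.
\<close>

definition diff_row :: "nat \<Rightarrow> (nat \<Rightarrow> nat \<Rightarrow> real) \<Rightarrow> nat \<Rightarrow> nat \<Rightarrow> nat \<Rightarrow> real"
  where "diff_row M v k i = (\<lambda>h. if h \<in> {..M} - {k} then (v h - v k) i else 0)"

definition proj_index :: "nat \<Rightarrow> nat \<Rightarrow> nat \<Rightarrow> (nat \<Rightarrow> nat \<Rightarrow> real) \<Rightarrow> nat \<Rightarrow> nat set"
  where "proj_index D R M v k = greedy_rows (diff_row M v k) R D"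

text \<open>The family \<open>(x\<^sub>i)\<close>, \<open>i \<in> I\<close>, as a vector of \<open>\<real>\<^sup>n\<close> with \<open>n = card I\<close>, in increasing order of \<open>i\<close>.\<close>

definition coord_proj :: "nat set \<Rightarrow> (nat \<Rightarrow> real) \<Rightarrow> nat \<Rightarrow> real"
  where "coord_proj I x = (\<lambda>j. if j < card I then x (sorted_list_of_set I ! j) else 0)"

end

theory Submission
  imports Defs
begin

text \<open>
  Fix a label \<open>k\<close> and consider the matrix with columns \<open>v h - v k\<close>. The directions of the convex
  hull of the velocities span the column space, so \<open>R\<close> is the column rank. Row rank equals column
  rank (\<open>row_rank_eq_column_rank\<close>), hence the greedy procedure finds exactly \<open>R\<close> rows and these
  span all rows (\<open>greedy_rows_basis\<close>). One linear map takes the rows for the label \<open>k\<close> to those for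
  any other label, and another one takes them back, so the rows have the same linear dependences
  for all labels; therefore the set \<open>I\<close> of selected indices does not depend on \<open>k\<close>
  (\<open>proj_index_label_independent\<close>).

  That row \<open>i\<close> is a combination of the rows in \<open>I\<close> means that all the velocities satisfy one and
  the same affine equation, expressing the \<open>i\<close>th coordinate through the coordinates in \<open>I\<close>
  (\<open>velocity_coordinate_affine\<close>). Integrating it over \<open>{0..t}\<close> along the path of \<open>V\<close> gives the
  same equation, with the constant term multiplied by \<open>t\<close>, for \<open>X t\<close>; and since affine equations
  survive convex combinations, every point of the convex hull of the \<open>t *\<^sub>R v h\<close> satisfies it too.
  Two vectors that satisfy these equations and agree on \<open>I\<close> are equal. In particular, if \<open>X t \<omega>\<close>
  has the same projection as a point \<open>a\<close> of this convex hull, then \<open>X t \<omega> = a\<close>. The argument works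
  for every \<open>\<omega>\<close> in the sample space, not only almost surely. Finally, the projection acts
  coordinatewise, so it commutes with the integral and maps the random motion to a random motion
  (\<open>random_motion_coord_proj\<close>).
\<close>


section \<open>Greedy selection of rows\<close>

text \<open>
  As long as fewer than \<open>R\<close> rows have been selected, a row is rejected only because it depends
  on the selected ones; the last conjunct records this. Once the bound \<open>R\<close> is reached, rows are
  rejected without any test, hence the premise \<open>card (I d) < R\<close>.
\<close>

lemma greedy_rows_invariant:
  fixes r :: "nat \<Rightarrow> 'a::real_vector" and R :: nat
  defines "I \<equiv> greedy_rows r R"
  shows "I d \<subseteq> {..<d} \<and> card (I d) \<le> R \<and> inj_on r (I d) \<and> independent (r ` I d) \<and>
    (card (I d) < R \<longrightarrow> r ` {..<d} \<subseteq> span (r ` I d))"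
proof (induction d)
  case 0
  then show ?case
    by (simp add: I_def independent_empty)
next
  case (Suc d)
  have fin: "finite (I d)" and d: "d \<notin> I d"
    using Suc finite_subset by blast+
  show ?case
  proof (cases "card (I d) < R \<and> r d \<notin> span (r ` I d)")
    case True
    have "r ` {..<d} \<subseteq> span (r ` insert d (I d))"
      using Suc True span_mono[of "r ` I d" "r ` insert d (I d)"] by auto
    then have "r ` {..<Suc d} \<subseteq> span (r ` insert d (I d))"
      by (auto simp: lessThan_Suc intro: span_base)
    moreover have "inj_on r (insert d (I d))"
      using Suc True d by (auto intro: span_base)
    moreover have "independent (r ` insert d (I d))"
      unfolding image_insert using Suc True by (intro independent_insertI) auto
    moreover have "I (Suc d) = insert d (I d)"
      using True by (simp add: I_def Let_def)
    ultimately show ?thesis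
      using Suc True fin d by (auto simp del: image_insert)
  next
    case False
    then have "I (Suc d) = I d"
      by (auto simp: I_def Let_def)
    then show ?thesis
      using Suc False by (auto simp: lessThan_Suc)
  qed
qed

text \<open>
  If the bound on the number of selected rows is the rank of all the rows, then it never causes
  the loss of a row: stopping short of \<open>R\<close> rows would leave a spanning set that is too small,
  while a row outside the span of \<open>R\<close> selected ones would give \<open>R + 1\<close> independent rows.
\<close>

lemma greedy_rows_basis:
  fixes r :: "nat \<Rightarrow> 'a::real_vector"
  assumes rank: "dim (r ` {..<d}) = R"
  defines "I \<equiv> greedy_rows r R d"
  shows "I \<subseteq> {..<d}" "card I = R" "inj_on r I" "r ` {..<d} \<subseteq> span (r ` I)"
proof -
  have inv: "I \<subseteq> {..<d}" "card I \<le> R" "inj_on r I" "independent (r ` I)"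
    "card I < R \<Longrightarrow> r ` {..<d} \<subseteq> span (r ` I)"
    using greedy_rows_invariant[of r R d] by (simp_all add: I_def)
  have fin: "finite I"
    using inv(1) finite_subset by blast
  show "I \<subseteq> {..<d}" "inj_on r I"
    by fact+
  show card: "card I = R"
  proof (rule ccontr)
    assume "card I \<noteq> R"
    then have "card I < R"
      using inv(2) by simp
    moreover from this have "dim (r ` {..<d}) \<le> card (r ` I)"
      using inv(5) fin by (intro dim_le_card) auto
    ultimately show False
      using rank card_image_le[OF fin, of r] by simp
  qed
  show "r ` {..<d} \<subseteq> span (r ` I)"
  proof (rule ccontr)
    assume "\<not> r ` {..<d} \<subseteq> span (r ` I)"
    then obtain x where x: "x \<in> r ` {..<d}" "x \<notin> span (r ` I)"
      by blast
    \<comment> \<open>The ambient space may be infinite-dimensional, so independent sets are bounded by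
      comparing them with a finite basis of the rows.\<close>
    obtain B where B: "B \<subseteq> r ` {..<d}" "independent B" "r ` {..<d} \<subseteq> span B" "card B = R"
      using basis_exists[of "r ` {..<d}"] rank by metis
    have "finite B"
      using B(1) finite_surj[of "{..<d}" B r] by simp
    moreover have "independent (insert x (r ` I))"
      using x inv by (intro independent_insertI)
    moreover have "insert x (r ` I) \<subseteq> span B"
      using x inv(1) B(3) by auto
    ultimately have "card (insert x (r ` I)) \<le> card B"
      using independent_span_bound by blast
    moreover have "card (insert x (r ` I)) = Suc R"
      using x fin card inv(3) by (subst card_insert_disjoint) (auto simp: card_image intro: span_base)
    ultimately show False
      using B(4) by simp
  qed
qed

text \<open>
  The selection depends only on the linear dependences between the rows, and these are preserved
  in both directions when the two families of rows are linear images of each other.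
\<close>

lemma greedy_rows_eqI:
  assumes "linear f" "linear g" "\<And>i. f (r i) = r' i" "\<And>i. g (r' i) = r i"
  shows "greedy_rows r R d = greedy_rows r' R d"
proof -
  have "r i \<in> span (r ` I) \<longleftrightarrow> r' i \<in> span (r' ` I)" for i I
  proof
    assume "r i \<in> span (r ` I)"
    then have "f (r i) \<in> span (f ` r ` I)"
      unfolding linear_span_image[OF assms(1)] by (rule imageI)
    then show "r' i \<in> span (r' ` I)"
      by (simp add: assms(3) image_image)
  next
    assume "r' i \<in> span (r' ` I)"
    then have "g (r' i) \<in> span (g ` r' ` I)"
      unfolding linear_span_image[OF assms(2)] by (rule imageI)
    then show "r i \<in> span (r ` I)"
      by (simp add: assms(4) image_image)
  qed
  then show ?thesis
    by (induction d) (simp_all add: Let_def)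
qed


section \<open>Row rank and column rank\<close>

lemma sum_fun_apply: "(\<Sum>a\<in>A. f a) x = (\<Sum>a\<in>A. f a x)"
  for f :: "'a \<Rightarrow> 'b \<Rightarrow> 'c::comm_monoid_add"
  by (induction A rule: infinite_finite_induct) auto

text \<open>
  Expanding each column in a basis \<open>B\<close> of the column space factors the matrix into one
  with the columns \<open>b \<in> B\<close> and the matrix of the coefficients. Read by rows, the factorization says
  that every row is a combination of the rows \<open>w b\<close> of the coefficient matrix, and there are at
  most \<open>card B\<close> of these.
\<close>

lemma row_rank_le_column_rank:
  fixes a :: "'i \<Rightarrow> 'h \<Rightarrow> real"
  assumes "finite H"
  shows "dim ((\<lambda>i h. if h \<in> H then a i h else 0) ` I)
    \<le> dim ((\<lambda>h i. if i \<in> I then a i h else 0) ` H)"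
proof -
  define row where "row = (\<lambda>i h. if h \<in> H then a i h else 0)"
  define col where "col = (\<lambda>h i. if i \<in> I then a i h else 0)"
  obtain B where B: "B \<subseteq> col ` H" "col ` H \<subseteq> span B" "card B = dim (col ` H)"
    using basis_exists[of "col ` H"] by metis
  have fin: "finite B"
    using B(1) assms finite_surj by blast
  have "\<forall>h\<in>H. \<exists>u. col h = (\<Sum>b\<in>B. u b *\<^sub>R b)"
    using B(2) by (auto simp: span_finite[OF fin])
  then obtain u where u: "\<And>h. h \<in> H \<Longrightarrow> col h = (\<Sum>b\<in>B. u h b *\<^sub>R b)"
    by metis
  define w where "w = (\<lambda>b h. if h \<in> H then u h b else 0)"
  have "row i = (\<Sum>b\<in>B. b i *\<^sub>R w b)" if "i \<in> I" for i
  proof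
    fix h
    have "row i h = (if h \<in> H then col h i else 0)"
      using that by (simp add: row_def col_def)
    also have "\<dots> = (\<Sum>b\<in>B. b i *\<^sub>R w b) h"
      by (simp add: u sum_fun_apply w_def mult.commute)
    finally show "row i h = (\<Sum>b\<in>B. b i *\<^sub>R w b) h" .
  qed
  then have "row ` I \<subseteq> span (w ` B)"
    by (auto intro!: span_sum intro: span_scale span_base)
  then have "dim (row ` I) \<le> card (w ` B)"
    using fin by (intro dim_le_card) auto
  also have "\<dots> \<le> card B"
    by (rule card_image_le[OF fin])
  finally show ?thesis
    by (simp add: B(3) row_def col_def)
qed

lemma row_rank_eq_column_rank:
  fixes a :: "'i \<Rightarrow> 'h \<Rightarrow> real"
  assumes "finite I" "finite H"
  shows "dim ((\<lambda>i h. if h \<in> H then a i h else 0) ` I)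
    = dim ((\<lambda>h i. if i \<in> I then a i h else 0) ` H)"
  using row_rank_le_column_rank[OF assms(2)] row_rank_le_column_rank[OF assms(1), of "\<lambda>h i. a i h"]
  by (rule order_antisym)

text \<open>
  The points that differ from \<open>a\<close> by an element of a fixed linear subspace form a convex set, so
  forming the convex hull adds no directions to those of \<open>S\<close>.
\<close>

lemma affine_dim_convex_hull:
  assumes "a \<in> S"
  shows "affine_dim (convex hull S) = dim ((\<lambda>x. x - a) ` S)"
proof -
  define L where "L = span ((\<lambda>x. x - a) ` S)"
  have "convex {x. x - a \<in> L}"
    unfolding convex_alt
  proof clarify
    fix x y :: 'a and u :: real
    assume "x - a \<in> L" "y - a \<in> L"
    then have "(1 - u) *\<^sub>R (x - a) + u *\<^sub>R (y - a) \<in> L"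
      unfolding L_def by (intro span_add span_scale)
    then show "(1 - u) *\<^sub>R x + u *\<^sub>R y - a \<in> L"
      by (simp add: algebra_simps)
  qed
  then have hull: "convex hull S \<subseteq> {x. x - a \<in> L}"
    by (intro hull_minimal) (auto simp: L_def intro: span_base)
  have "x - y \<in> L" if "x \<in> convex hull S" "y \<in> convex hull S" for x y
  proof -
    have "(x - a) - (y - a) \<in> L"
      unfolding L_def by (rule span_diff) (use that hull in \<open>auto simp: L_def\<close>)
    then show ?thesis
      by simp
  qed
  then have "span {x - y | x y. x \<in> convex hull S \<and> y \<in> convex hull S} \<subseteq> L"
    unfolding L_def by (intro span_minimal) auto
  moreover have "L \<subseteq> span {x - y | x y. x \<in> convex hull S \<and> y \<in> convex hull S}"
    unfolding L_def using assms by (intro span_mono) (auto intro: hull_inc)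
  ultimately show ?thesis
    unfolding affine_dim_def L_def by (intro span_eq_dim subset_antisym)
qed


section \<open>The coordinates selected from the velocities\<close>

text \<open>
  The entry \<open>v k i - v k i\<close> at the label \<open>k\<close> is zero. In this form the condition on \<open>h\<close> is
  the same for all \<open>k\<close>, which makes rows for different \<open>k\<close> comparable.
\<close>

lemma diff_row_eq: "diff_row M v k i = (\<lambda>h. if h \<in> {..M} then v h i - v k i else 0)"
  by (auto simp: diff_row_def)

lemma dim_diff_rows:
  assumes "k \<le> M" "\<And>h i. h \<le> M \<Longrightarrow> i \<ge> D \<Longrightarrow> v h i = 0"
  shows "dim (diff_row M v k ` {..<D}) = affine_dim (convex hull (v ` {..M}))"
proof -
  have "(\<lambda>h i. if i \<in> {..<D} then v h i - v k i else 0) ` {..M} = (\<lambda>x. x - v k) ` v ` {..M}"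
    unfolding image_image using assms by (intro image_cong) (auto simp: fun_eq_iff not_less)
  then show ?thesis
    using row_rank_eq_column_rank[of "{..<D}" "{..M}" "\<lambda>i h. v h i - v k i"] assms(1)
    by (simp add: diff_row_eq[abs_def] affine_dim_convex_hull[of "v k"])
qed

lemma proj_index_label_independent:
  assumes "k \<le> M" "l \<le> M"
  shows "proj_index D R M v k = proj_index D R M v l"
proof -
  \<comment> \<open>Since \<open>(v h - v l) i = (v h - v k) i - (v l - v k) i\<close>, the rows for \<open>l\<close> arise from those
    for \<open>k\<close> by subtracting the entry at \<open>l\<close>; this map does not depend on the row or on \<open>k\<close>.\<close>
  define rebase where "rebase l f = (\<lambda>h. if h \<in> {..M} then f h - f l else 0)" 
    for l and f :: "nat \<Rightarrow> real"
  have "linear (rebase l)" for l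
    by (rule linearI) (auto simp: rebase_def fun_eq_iff algebra_simps)
  moreover have "rebase l (diff_row M v k i) = diff_row M v l i" if "k \<le> M" "l \<le> M" for k l i
    using that by (auto simp: rebase_def diff_row_eq)
  ultimately show ?thesis
    unfolding proj_index_def using assms by (intro greedy_rows_eqI[of "rebase l" "rebase k"]) auto
qed

text \<open>
  This is the relation expressing row \<open>i\<close> through the selected rows, read off at the label \<open>h\<close>.
  The terms with \<open>v k\<close> do not depend on \<open>h\<close> and make up the constant \<open>b\<close>.
\<close>

lemma velocity_coordinate_affine:
  assumes rank: "dim (diff_row M v k ` {..<D}) = R" and k: "k \<le> M" and i: "i < D"
  defines "I \<equiv> proj_index D R M v k"
  shows "\<exists>b c. \<forall>h\<le>M. v h i = b + (\<Sum>j\<in>I. c j * v h j)"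
proof -
  define r where "r = diff_row M v k"
  have I: "I \<subseteq> {..<D}" "inj_on r I" "r ` {..<D} \<subseteq> span (r ` I)"
    using greedy_rows_basis[OF rank] by (simp_all add: I_def proj_index_def r_def)
  have "finite (r ` I)"
    using I(1) finite_subset by blast
  moreover have "r i \<in> span (r ` I)"
    using I(3) i by auto
  ultimately obtain u where "r i = (\<Sum>x\<in>r ` I. u x *\<^sub>R x)"
    by (auto simp: span_finite)
  then have ri: "r i = (\<Sum>j\<in>I. u (r j) *\<^sub>R r j)"
    by (simp add: sum.reindex[OF I(2)])
  have "v h i = (v k i - (\<Sum>j\<in>I. u (r j) * v k j)) + (\<Sum>j\<in>I. u (r j) * v h j)" if "h \<le> M" for h
    using fun_cong[OF ri, of h] that
    by (simp add: sum_fun_apply r_def diff_row_eq right_diff_distrib sum_subtractf)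
  then show ?thesis
    by (intro exI[of _ "v k i - (\<Sum>j\<in>I. u (r j) * v k j)"] exI[of _ "\<lambda>j. u (r j)"]) simp
qed

lemma coord_proj_eq_iff:
  assumes "finite I"
  shows "coord_proj I x = coord_proj I y \<longleftrightarrow> (\<forall>i\<in>I. x i = y i)"
proof -
  define xs where "xs = sorted_list_of_set I"
  have "(\<lambda>j. xs ! j) ` {..<card I} = set xs"
    by (auto simp: xs_def set_conv_nth)
  then have img: "(\<lambda>j. xs ! j) ` {..<card I} = I"
    using assms by (simp add: xs_def)
  have "(\<forall>i\<in>I. x i = y i) \<longleftrightarrow> (\<forall>i\<in>(\<lambda>j. xs ! j) ` {..<card I}. x i = y i)"
    by (simp only: img)
  also have "\<dots> \<longleftrightarrow> (\<forall>j<card I. x (xs ! j) = y (xs ! j))"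
    by blast
  finally show ?thesis
    by (auto simp: coord_proj_def fun_eq_iff xs_def)
qed


section \<open>Random motions\<close>

lemma convex_affine_equation:
  fixes c :: "'i \<Rightarrow> real"
  shows "convex {x. x i = b + (\<Sum>j\<in>I. c j * x j)}"
  unfolding convex_alt
proof clarify
  fix x y :: "'i \<Rightarrow> real" and u :: real
  assume eq: "x i = b + (\<Sum>j\<in>I. c j * x j)" "y i = b + (\<Sum>j\<in>I. c j * y j)"
  have "(\<Sum>j\<in>I. c j * ((1 - u) *\<^sub>R x + u *\<^sub>R y) j)
      = (1 - u) * (\<Sum>j\<in>I. c j * x j) + u * (\<Sum>j\<in>I. c j * y j)"
    by (simp add: distrib_left sum.distrib sum_distrib_left mult.left_commute)
  then show "((1 - u) *\<^sub>R x + u *\<^sub>R y) i = b + (\<Sum>j\<in>I. c j * ((1 - u) *\<^sub>R x + u *\<^sub>R y) j)"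
    by (simp add: eq ring_distribs)
qed

text \<open>
  Scaling the velocities by \<open>t\<close> scales the constant term of the equation, and the solutions of an
  affine equation form a convex set.
\<close>

lemma convex_hull_affine_equation:
  assumes "\<And>h. h \<le> M \<Longrightarrow> v h i = b + (\<Sum>j\<in>I. c j * v h j)"
    and "x \<in> convex hull ((\<lambda>h. t *\<^sub>R v h) ` {..M})"
  shows "x i = t * b + (\<Sum>j\<in>I. c j * x j)"
proof -
  have "convex hull ((\<lambda>h. t *\<^sub>R v h) ` {..M}) \<subseteq> {x. x i = t * b + (\<Sum>j\<in>I. c j * x j)}"
    by (intro hull_minimal convex_affine_equation)
      (auto simp: assms(1) distrib_left sum_distrib_left mult.left_commute)
  then show ?thesis
    using assms(2) by blast
qed

text \<open>
  At every time the velocity is one of the \<open>v h\<close>, so the affine equation holds for the integrand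
  pointwise and passes to the integral. Measurability into the count space makes this true for
  every point of the sample space.
\<close>

lemma motion_affine_equation:
  assumes "random_motion P W D M v V X" "t \<ge> 0" "\<omega> \<in> space P" "finite I"
    and eq: "\<And>h. h \<le> M \<Longrightarrow> v h i = b + (\<Sum>j\<in>I. c j * v h j)"
  shows "X t \<omega> i = t * b + (\<Sum>j\<in>I. c j * X t \<omega> j)"
proof -
  have int: "((\<lambda>s. V s \<omega> j) has_integral X t \<omega> j) {0..t}" for j
    using assms(1-3) by (simp add: random_motion_def)
  have V: "V s \<omega> i = b + (\<Sum>j\<in>I. c j * V s \<omega> j)" if "s \<in> {0..t}" for s
  proof -
    have "V s \<in> measurable P (count_space (v ` {..M}))"
      using assms(1) that by (simp add: random_motion_def)
    from measurable_space[OF this assms(3)] have "V s \<omega> \<in> v ` {..M}"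
      by simp
    then show ?thesis
      using eq by auto
  qed
  have "((\<lambda>s. b + (\<Sum>j\<in>I. c j * V s \<omega> j)) has_integral (t * b + (\<Sum>j\<in>I. c j * X t \<omega> j))) {0..t}"
    using has_integral_const_real[of b 0 t] assms(2)
    by (intro has_integral_add has_integral_sum has_integral_mult_right int assms(4)) auto
  then have "((\<lambda>s. V s \<omega> i) has_integral (t * b + (\<Sum>j\<in>I. c j * X t \<omega> j))) {0..t}"
    by (rule has_integral_eq[rotated]) (simp add: V)
  then show ?thesis
    by (rule has_integral_unique[OF int])
qed

lemma random_motion_coord_proj:
  assumes "random_motion P W D M v V X"
  shows "random_motion P W (card I) M (\<lambda>h. coord_proj I (v h))
    (\<lambda>t \<omega>. coord_proj I (V t \<omega>)) (\<lambda>t \<omega>. coord_proj I (X t \<omega>))"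
  unfolding random_motion_def
proof (intro conjI allI impI ballI)
  show "point_process P W"
    using assms by (simp add: random_motion_def)
next
  fix h
  show "coord_proj I (v h) \<in> topspace (Euclidean_space (card I))"
    by (simp add: topspace_Euclidean_space coord_proj_def)
next
  fix t :: real
  assume "0 \<le> t"
  then have "V t \<in> measurable P (count_space (v ` {..M}))"
    using assms by (simp add: random_motion_def)
  moreover have "coord_proj I \<in>
      measurable (count_space (v ` {..M})) (count_space ((\<lambda>h. coord_proj I (v h)) ` {..M}))"
    by auto
  ultimately show "(\<lambda>\<omega>. coord_proj I (V t \<omega>))
      \<in> measurable P (count_space ((\<lambda>h. coord_proj I (v h)) ` {..M}))"
    by (rule measurable_compose)
next
  have "AE \<omega> in P. \<forall>t\<ge>0. V t \<omega> = V (arrival W (the_enat (counting W t \<omega>)) \<omega>) \<omega>"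
    using assms by (simp add: random_motion_def)
  then show "AE \<omega> in P. \<forall>t\<ge>0. coord_proj I (V t \<omega>) =
      coord_proj I (V (arrival W (the_enat (counting W t \<omega>)) \<omega>) \<omega>)"
    by eventually_elim metis
next
  fix t :: real and \<omega> j
  assume "0 \<le> t" "\<omega> \<in> space P"
  then show "((\<lambda>s. coord_proj I (V s \<omega>) j) has_integral coord_proj I (X t \<omega>) j) {0..t}"
    using assms by (simp add: random_motion_def coord_proj_def)
qed

theorem proposition3p1:
  fixes P :: "'w measure"
    and W :: "nat \<Rightarrow> 'w \<Rightarrow> real"
    and D M R :: nat
    and v :: "nat \<Rightarrow> nat \<Rightarrow> real"
    and V X :: "real \<Rightarrow> 'w \<Rightarrow> nat \<Rightarrow> real"
  assumes "random_motion P W D M v V X"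
    and "affine_dim (convex hull (v ` {..M})) = R"
    and "R \<le> D"
  shows "\<exists>I. (\<forall>k\<le>M. proj_index D R M v k = I) \<and> card I = R \<and>
    coord_proj I \<in> topspace (Euclidean_space D) \<rightarrow> topspace (Euclidean_space R) \<and>
    (\<forall>t\<ge>0. \<forall>A \<subseteq> convex hull ((\<lambda>h. t *\<^sub>R v h) ` {..M}).
      {\<omega> \<in> space P. X t \<omega> \<in> A} = {\<omega> \<in> space P. coord_proj I (X t \<omega>) \<in> coord_proj I ` A}) \<and>
    random_motion P W R M (\<lambda>h. coord_proj I (v h))
      (\<lambda>t \<omega>. coord_proj I (V t \<omega>)) (\<lambda>t \<omega>. coord_proj I (X t \<omega>))"
proof -
  define I where "I = proj_index D R M v 0"
  have supp: "v h i = 0" if "h \<le> M" "D \<le> i" for h i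
    using assms(1) that by (simp add: random_motion_def topspace_Euclidean_space)
  have rank: "dim (diff_row M v 0 ` {..<D}) = R"
    using dim_diff_rows[of 0 M D v] supp assms(2) by simp
  have I: "I \<subseteq> {..<D}" "card I = R"
    using greedy_rows_basis[OF rank] by (simp_all add: I_def proj_index_def)
  have fin: "finite I"
    using I(1) finite_subset by blast
  \<comment> \<open>Coordinates from \<open>D\<close> on vanish for all velocities, which is an affine equation as well.\<close>
  have affine: "\<exists>b c. \<forall>h\<le>M. v h i = b + (\<Sum>j\<in>I. c j * v h j)" for i
  proof (cases "i < D")
    case True
    then show ?thesis
      using velocity_coordinate_affine[OF rank] by (simp add: I_def)
  next
    case False
    then show ?thesis
      using supp by (intro exI[of _ 0] exI[of _ "\<lambda>_. 0"]) simp
  qed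
  have determined: "X t \<omega> = a"
    if t: "t \<ge> 0" and \<omega>: "\<omega> \<in> space P" and a: "a \<in> convex hull ((\<lambda>h. t *\<^sub>R v h) ` {..M})"
      and eq: "coord_proj I (X t \<omega>) = coord_proj I a" for t \<omega> a
  proof
    fix i
    obtain b c where "\<And>h. h \<le> M \<Longrightarrow> v h i = b + (\<Sum>j\<in>I. c j * v h j)"
      using affine by blast
    then have "X t \<omega> i = t * b + (\<Sum>j\<in>I. c j * X t \<omega> j)" "a i = t * b + (\<Sum>j\<in>I. c j * a j)"
      using motion_affine_equation[OF assms(1) t \<omega> fin] convex_hull_affine_equation[OF _ a] by blast+
    moreover have "\<forall>j\<in>I. X t \<omega> j = a j"
      using eq coord_proj_eq_iff[OF fin] by blast
    ultimately show "X t \<omega> i = a i"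
      by simp
  qed
  show ?thesis
  proof (intro exI[of _ I] conjI allI impI)
    show "proj_index D R M v k = I" if "k \<le> M" for k
      unfolding I_def using that by (intro proj_index_label_independent) auto
    show "card I = R"
      by (rule I(2))
    show "coord_proj I \<in> topspace (Euclidean_space D) \<rightarrow> topspace (Euclidean_space R)"
      using I(2) by (auto simp: topspace_Euclidean_space coord_proj_def)
    show "{\<omega> \<in> space P. X t \<omega> \<in> A} = {\<omega> \<in> space P. coord_proj I (X t \<omega>) \<in> coord_proj I ` A}"
      if "0 \<le> t" "A \<subseteq> convex hull ((\<lambda>h. t *\<^sub>R v h) ` {..M})" for t A
      using determined that by blast
    show "random_motion P W R M (\<lambda>h. coord_proj I (v h))
        (\<lambda>t \<omega>. coord_proj I (V t \<omega>)) (\<lambda>t \<omega>. coord_proj I (X t \<omega>))"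
      using random_motion_coord_proj[OF assms(1), of I] I(2) by simp
  qed
qed

end
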